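(* There exists an absolute constant $c>0$ such that the following holds. Let $L,\theta>0$ be constants and let $Z,W$ be real random variables such that for every $\lambda>0$ $$\mathrm{Ent}(e^{\lambda Z})\le\lambda^2\,\mathbb{E}\bigl[We^{\lambda Z}\bigr],$$ and such that for every $t\ge0$ $$\mathbb{P}(W>L+\theta t)\le e^{-t}.$$ Then for every $t\ge0$ $$\mathbb{P}(Z-\mathbb{E}Z>t)\le\exp\left(-c\min\left\{\frac{t^2}{L+\theta},\frac{t}{\sqrt{\theta}}\right\}\right).$$ If, moreover, the inequality $\mathrm{Ent}(e^{\lambda Z})\le\lambda^2\,\mathbb{E}[We^{\lambda Z}]$ also holds for every $\lambda\le0$, then for every $t\ge0$ $$\mathbb{P}(|Z-\mathbb{E}Z|>t)\le2\exp\left(-c\min\left\{\frac{t^2}{L+\theta},\frac{t}{\sqrt{\theta}}\right\}\right).$$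
   Context: For a non-negative random variable $Y$, its entropy is $\mathrm{Ent}(Y)=\mathbb{E}[Y\log Y]-\mathbb{E}[Y]\log\mathbb{E}[Y]$. The hypotheses are understood to include that the quantities appearing in them ($\mathbb{E}Z$, $\mathbb{E}e^{\lambda Z}$, $\mathrm{Ent}(e^{\lambda Z})$, $\mathbb{E}[We^{\lambda Z}]$) are well defined and finite for the $\lambda$ considered. *)

theory Defs
  imports "HOL-Probability.Probability"
begin

definition Ent :: "'a measure \<Rightarrow> ('a \<Rightarrow> real) \<Rightarrow> real" where
  "Ent M Y = (\<integral>\<omega>. Y \<omega> * ln (Y \<omega>) \<partial>M) - (\<integral>\<omega>. Y \<omega> \<partial>M) * ln (\<integral>\<omega>. Y \<omega> \<partial>M)"

(* The parameter s is the lambda of the mathematics (a reserved symbol in Isabelle).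
   The Bochner integral is 0 for non-integrable functions, so the finiteness of
   E[e^(lambda Z)], Ent(e^(lambda Z)) and E[W e^(lambda Z)] is stated explicitly. *)
definition entropy_bound :: "'a measure \<Rightarrow> ('a \<Rightarrow> real) \<Rightarrow> ('a \<Rightarrow> real) \<Rightarrow> real \<Rightarrow> bool" where
  "entropy_bound M Z W s \<longleftrightarrow>
     integrable M (\<lambda>\<omega>. exp (s * Z \<omega>)) \<and>
     integrable M (\<lambda>\<omega>. exp (s * Z \<omega>) * ln (exp (s * Z \<omega>))) \<and>
     integrable M (\<lambda>\<omega>. W \<omega> * exp (s * Z \<omega>)) \<and>
     Ent M (\<lambda>\<omega>. exp (s * Z \<omega>)) \<le> s\<^sup>2 * (\<integral>\<omega>. W \<omega> * exp (s * Z \<omega>) \<partial>M)"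

(* "c is a valid constant for all random variables on probability spaces over the type 'a". *)
definition tail_constant :: "'a itself \<Rightarrow> real \<Rightarrow> bool" where
  "tail_constant (_ :: 'a itself) c \<longleftrightarrow>
     (\<forall>(M :: 'a measure) (Z :: 'a \<Rightarrow> real) (W :: 'a \<Rightarrow> real) (L :: real) (\<theta> :: real).
        prob_space M \<longrightarrow> L > 0 \<longrightarrow> \<theta> > 0 \<longrightarrow>
        Z \<in> borel_measurable M \<longrightarrow> W \<in> borel_measurable M \<longrightarrow> integrable M Z \<longrightarrow>
        (\<forall>s>0. entropy_bound M Z W s) \<longrightarrow>
        (\<forall>t\<ge>0. measure M {\<omega> \<in> space M. W \<omega> > L + \<theta> * t} \<le> exp (- t)) \<longrightarrow>
        (\<forall>t\<ge>0. measure M {\<omega> \<in> space M. Z \<omega> - (\<integral>\<omega>'. Z \<omega>' \<partial>M) > t}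
                 \<le> exp (- c * min (t\<^sup>2 / (L + \<theta>)) (t / sqrt \<theta>))) \<and>
        ((\<forall>s\<le>0. entropy_bound M Z W s) \<longrightarrow>
          (\<forall>t\<ge>0. measure M {\<omega> \<in> space M. \<bar>Z \<omega> - (\<integral>\<omega>'. Z \<omega>' \<partial>M)\<bar> > t}
                   \<le> 2 * exp (- c * min (t\<^sup>2 / (L + \<theta>)) (t / sqrt \<theta>)))))"

(* Pitfall: "EX c > 0. tail_constant TYPE('a) c" alone would let c depend on the sample
   type 'a, and HOL cannot quantify over types under the existential.  Absoluteness of c
   is therefore expressed by "EX c > 0. tail_constant TYPE(real \<times> real) c" together with
   "every c > 0 valid over real \<times> real is valid over 'a", with 'a a free, hence arbitrary,
   type variable: one and the same c then serves all sample spaces. *)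

end

theory Submission
  imports Defs "HOL-Real_Asymp.Real_Asymp"
begin

text \<open>
  Write \<open>G s = E[exp (s Z)]\<close> and \<open>\<psi> s = ln (G s)\<close>. The argument is Herbst's, with the weight \<open>W\<close>
  removed by entropy duality and the usual differential inequality replaced by a halving step.

  The tail hypothesis says that \<open>(W - L) / (2 \<theta>)\<close> has a bounded exponential moment
  (\<open>exp_moment_of_exponential_tail\<close>). Young's inequality \<open>u y \<le> y ln y - y + exp u\<close>, applied to
  \<open>u = (W - L) / (2 \<theta>)\<close> and to the normalised density \<open>y = exp (s Z) / G s\<close>, therefore bounds
  \<open>E[W exp (s Z)]\<close> by \<open>L G s + 2 \<theta> (Ent (exp (s Z)) + G s)\<close>. For \<open>s\<close> up to \<open>1 / (2 sqrt \<theta>)\<close>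
  the entropy on the right is absorbed by the left side of the hypothesis, which leaves
  \<open>Ent (exp (s Z)) \<le> 4 (L + \<theta>) s\<^sup>2 G s\<close> (\<open>entropy_self_bound\<close>).

  With \<open>K = 4 (L + \<theta>)\<close> this yields \<open>\<psi> s / s \<le> \<psi> (s/2) / (s/2) + K s\<close> (\<open>cumulant_halving\<close>);
  iterating, and using that \<open>\<psi> r / r\<close> is asymptotically at most \<open>E[Z]\<close> as \<open>r\<close> tends to 0, gives
  \<open>\<psi> s \<le> s E[Z] + 2 K s\<^sup>2\<close> (\<open>Herbst_mgf_bound\<close>). Markov's inequality with the best
  admissible \<open>s\<close> produces the upper tail with the constant 1/32 on every sample space, and the
  lower tail is the upper tail of \<open>-Z\<close>.

  All hypotheses and conclusions depend only on the joint law of \<open>(Z, W)\<close>, so a constant that is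
  valid on \<open>real \<times> real\<close> is valid on any other sample type (\<open>tail_constant_transfer\<close>).
\<close>

section \<open>Exponential moments and entropy duality\<close>

text \<open>
  Layer-cake formula: \<open>exp u \<le> 1 + (\<integral>s\<in>{0..<u}. exp s)\<close>, and the event \<open>u > s\<close>, that is
  \<open>W > L + \<theta> (2 s)\<close>, has probability at most \<open>exp (-2 s)\<close>. The factor 2 in the exponent
  is what makes the resulting integral of \<open>exp s * exp (-2 s)\<close> converge (to 1).
\<close>

lemma exp_moment_of_exponential_tail:
  fixes W :: "'a \<Rightarrow> real" and L \<theta> :: real
  assumes M: "prob_space M" and [measurable]: "W \<in> borel_measurable M" and th: "\<theta> > 0"
    and tail: "\<And>t. t \<ge> 0 \<Longrightarrow> measure M {\<omega> \<in> space M. W \<omega> > L + \<theta> * t} \<le> exp (- t)"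
  shows "integrable M (\<lambda>\<omega>. exp ((W \<omega> - L) / (2 * \<theta>)))"
    and "(\<integral>\<omega>. exp ((W \<omega> - L) / (2 * \<theta>)) \<partial>M) \<le> 2"
proof -
  interpret prob_space M by fact
  interpret P: pair_sigma_finite M lborel ..
  define u where "u \<omega> = (W \<omega> - L) / (2 * \<theta>)" for \<omega>
  have [measurable]: "u \<in> borel_measurable M" unfolding u_def by measurable
  define f :: "'a \<Rightarrow> real \<Rightarrow> ennreal" where
    "f \<omega> s = ennreal (exp s) * (if 0 \<le> s \<and> s < u \<omega> then 1 else 0)" for \<omega> s
  have [measurable]: "(\<lambda>(\<omega>, s). f \<omega> s) \<in> borel_measurable (M \<Otimes>\<^sub>M lborel)"
    unfolding f_def by measurable
  have le: "ennreal (exp (u \<omega>)) \<le> 1 + (\<integral>\<^sup>+s. f \<omega> s \<partial>lborel)" if "\<omega> \<in> space M" for \<omega>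
  proof (cases "u \<omega> \<le> 0")
    case True
    then have "ennreal (exp (u \<omega>)) \<le> 1" by simp
    then show ?thesis by (metis add.right_neutral add_mono zero_le)
  next
    case False
    have "(\<integral>\<^sup>+s. f \<omega> s \<partial>lborel) = (\<integral>\<^sup>+s. ennreal (exp s) * indicator {0..u \<omega>} s \<partial>lborel)"
      by (rule nn_integral_cong_AE, rule AE_mp[OF AE_lborel_singleton[of "u \<omega>"]])
         (auto simp: f_def indicator_def)
    also have "\<dots> = ennreal (exp (u \<omega>) - exp 0)"
      by (rule nn_integral_FTC_Icc) (use False in \<open>auto intro!: derivative_eq_intros\<close>)
    finally have "1 + (\<integral>\<^sup>+s. f \<omega> s \<partial>lborel) = ennreal (1 + (exp (u \<omega>) - 1))"
      using False by (subst ennreal_plus) auto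
    then show ?thesis by simp
  qed
  have "(\<integral>\<^sup>+\<omega>. (\<integral>\<^sup>+s. f \<omega> s \<partial>lborel) \<partial>M) = (\<integral>\<^sup>+s. (\<integral>\<^sup>+\<omega>. f \<omega> s \<partial>M) \<partial>lborel)"
    by (rule P.Fubini'[symmetric]) simp
  also have "\<dots> \<le> (\<integral>\<^sup>+s. ennreal (exp (- s)) * indicator {0..} s \<partial>lborel)"
  proof (rule nn_integral_mono)
    fix s :: real
    have "(\<integral>\<^sup>+\<omega>. f \<omega> s \<partial>M) = 0" if "s < 0"
      using that by (simp add: f_def)
    moreover have "(\<integral>\<^sup>+\<omega>. f \<omega> s \<partial>M) \<le> ennreal (exp (- s))" if "s \<ge> 0"
    proof -
      have eq: "{\<omega> \<in> space M. s < u \<omega>} = {\<omega> \<in> space M. W \<omega> > L + \<theta> * (2 * s)}"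
        using th by (auto simp: u_def field_simps)
      have "(\<integral>\<^sup>+\<omega>. f \<omega> s \<partial>M)
          = (\<integral>\<^sup>+\<omega>. ennreal (exp s) * indicator {\<omega> \<in> space M. s < u \<omega>} \<omega> \<partial>M)"
        by (rule nn_integral_cong) (use that in \<open>auto simp: f_def indicator_def\<close>)
      also have "\<dots> = ennreal (exp s) * emeasure M {\<omega> \<in> space M. s < u \<omega>}"
        by (simp add: nn_integral_cmult)
      also have "\<dots> = ennreal (exp s * measure M {\<omega> \<in> space M. s < u \<omega>})"
        by (simp add: emeasure_eq_measure ennreal_mult)
      also have "\<dots> \<le> ennreal (exp s * exp (- (2 * s)))"
        unfolding eq using tail[of "2 * s"] that by (intro ennreal_leI mult_left_mono) auto
      also have "exp s * exp (- (2 * s)) = exp (- s)"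
        by (simp flip: exp_add)
      finally show ?thesis .
    qed
    ultimately show "(\<integral>\<^sup>+\<omega>. f \<omega> s \<partial>M) \<le> ennreal (exp (- s)) * indicator {0..} s"
      by (cases "s < 0") (auto simp: indicator_def)
  qed
  also have "\<dots> = ennreal (0 - (- exp (- 0)))"
  proof (rule nn_integral_FTC_atLeast)
    show "((\<lambda>x. - exp (- x)) \<longlongrightarrow> (0::real)) at_top"
      by real_asymp
  qed (auto intro!: derivative_eq_intros)
  finally have i1: "(\<integral>\<^sup>+\<omega>. (\<integral>\<^sup>+s. f \<omega> s \<partial>lborel) \<partial>M) \<le> 1" by simp
  have "(\<integral>\<^sup>+\<omega>. ennreal (exp (u \<omega>)) \<partial>M) \<le> (\<integral>\<^sup>+\<omega>. (1 + (\<integral>\<^sup>+s. f \<omega> s \<partial>lborel)) \<partial>M)"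
    by (rule nn_integral_mono) (rule le)
  also have "\<dots> = 1 + (\<integral>\<^sup>+\<omega>. (\<integral>\<^sup>+s. f \<omega> s \<partial>lborel) \<partial>M)"
    by (subst nn_integral_add) (auto simp: emeasure_space_1)
  also have "\<dots> \<le> 1 + 1" by (intro add_mono i1) simp
  finally have nn: "(\<integral>\<^sup>+\<omega>. ennreal (exp (u \<omega>)) \<partial>M) \<le> ennreal 2" by simp
  have int: "integrable M (\<lambda>\<omega>. exp (u \<omega>))"
    by (rule integrableI_nonneg) (use nn in \<open>auto simp: less_top[symmetric] top_unique\<close>)
  then show "integrable M (\<lambda>\<omega>. exp ((W \<omega> - L) / (2 * \<theta>)))"
    by (simp add: u_def)
  have "(\<integral>\<omega>. exp (u \<omega>) \<partial>M) \<le> 2"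
    using nn nn_integral_eq_integral[OF int] ennreal_le_iff[of 2] by (simp del: ennreal_numeral)
  then show "(\<integral>\<omega>. exp ((W \<omega> - L) / (2 * \<theta>)) \<partial>M) \<le> 2"
    by (simp add: u_def)
qed

text \<open>The exponential and \<open>y ln y - y\<close> are convex conjugates.\<close>

lemma Young_exp:
  fixes u y :: real
  assumes "y > 0"
  shows "u * y \<le> y * ln y - y + exp u"
proof -
  have "1 + (u - ln y) \<le> exp (u - ln y)" by (rule exp_ge_add_one_self)
  also have "exp (u - ln y) = exp u / y" using assms by (simp add: exp_diff)
  finally show ?thesis using assms by (simp add: field_simps)
qed

lemma (in prob_space) integral_exp_pos:
  fixes f :: "'a \<Rightarrow> real"
  assumes "integrable M (\<lambda>\<omega>. exp (f \<omega>))"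
  shows "(\<integral>\<omega>. exp (f \<omega>) \<partial>M) > 0"
proof -
  have "(\<integral>\<omega>. exp (f \<omega>) \<partial>M) \<noteq> 0"
    using integral_nonneg_eq_0_iff_AE[OF assms] AE_False by simp
  moreover have "(\<integral>\<omega>. exp (f \<omega>) \<partial>M) \<ge> 0" by simp
  ultimately show ?thesis by linarith
qed

text \<open>
  The condition on \<open>s\<close> makes the coefficient \<open>2 \<theta> s\<^sup>2\<close> of the entropy on the right-hand side at
  most 1/2, so that it can be absorbed on the left.
\<close>

lemma (in prob_space) entropy_self_bound:
  fixes Z W :: "'a \<Rightarrow> real" and L \<theta> s :: real
  assumes Wm: "W \<in> borel_measurable M" and th: "\<theta> > 0" and L: "L > 0"
    and tail: "\<And>t. t \<ge> 0 \<Longrightarrow> measure M {\<omega> \<in> space M. W \<omega> > L + \<theta> * t} \<le> exp (- t)"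
    and eb: "entropy_bound M Z W s" and s: "4 * \<theta> * s\<^sup>2 \<le> 1"
  shows "Ent M (\<lambda>\<omega>. exp (s * Z \<omega>)) \<le> 4 * (L + \<theta>) * s\<^sup>2 * (\<integral>\<omega>. exp (s * Z \<omega>) \<partial>M)"
proof -
  define G where "G = (\<integral>\<omega>. exp (s * Z \<omega>) \<partial>M)"
  define E where "E = Ent M (\<lambda>\<omega>. exp (s * Z \<omega>))"
  define I where "I = (\<integral>\<omega>. W \<omega> * exp (s * Z \<omega>) \<partial>M)"
  from eb have i1[simp]: "integrable M (\<lambda>\<omega>. exp (s * Z \<omega>))"
    and i2: "integrable M (\<lambda>\<omega>. exp (s * Z \<omega>) * ln (exp (s * Z \<omega>)))"
    and i3[simp]: "integrable M (\<lambda>\<omega>. W \<omega> * exp (s * Z \<omega>))"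
    and EI: "E \<le> s\<^sup>2 * I"
    unfolding entropy_bound_def E_def I_def by auto
  have G: "G > 0" unfolding G_def by (rule integral_exp_pos) simp
  have em: "integrable M (\<lambda>\<omega>. exp ((W \<omega> - L) / (2 * \<theta>)))"
      "(\<integral>\<omega>. exp ((W \<omega> - L) / (2 * \<theta>)) \<partial>M) \<le> 2"
    using exp_moment_of_exponential_tail[OF prob_space_axioms Wm th] tail by blast+
  \<comment> \<open>Young's inequality for \<open>u\<close> and \<open>y\<close> as below, multiplied by \<open>2 * \<theta> * G\<close>.\<close>
  have pt: "W \<omega> * exp (s * Z \<omega>) \<le> L * exp (s * Z \<omega>) + 2 * \<theta> * (exp (s * Z \<omega>) * ln (exp (s * Z \<omega>))
      - (ln G + 1) * exp (s * Z \<omega>) + G * exp ((W \<omega> - L) / (2 * \<theta>)))" for \<omega>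
  proof -
    define y where "y = exp (s * Z \<omega>) / G"
    define u where "u = (W \<omega> - L) / (2 * \<theta>)"
    have y: "y > 0" "exp (s * Z \<omega>) = G * y" using G by (auto simp: y_def)
    have W: "W \<omega> = L + 2 * \<theta> * u" using th by (simp add: u_def)
    have "2 * \<theta> * G * (u * y) \<le> 2 * \<theta> * G * (y * ln y - y + exp u)"
      using Young_exp[OF y(1), of u] th G by (intro mult_left_mono) auto
    then show ?thesis
      using y G unfolding u_def[symmetric] y(2)
      by (subst W) (simp add: ln_mult algebra_simps)
  qed
  have "I \<le> (\<integral>\<omega>. L * exp (s * Z \<omega>) + 2 * \<theta> * (exp (s * Z \<omega>) * ln (exp (s * Z \<omega>))
      - (ln G + 1) * exp (s * Z \<omega>) + G * exp ((W \<omega> - L) / (2 * \<theta>))) \<partial>M)"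
    unfolding I_def
    by (intro integral_mono pt Bochner_Integration.integrable_add integrable_mult_right
        Bochner_Integration.integrable_diff i1 i2 i3 em)
  also have "\<dots> = L * G + 2 * \<theta> * (E - G + G * (\<integral>\<omega>. exp ((W \<omega> - L) / (2 * \<theta>)) \<partial>M))"
  proof -
    have lin: "(\<integral>\<omega>. L * a \<omega> + 2 * \<theta> * (b \<omega> - k * a \<omega> + G * e \<omega>) \<partial>M)
        = L * (\<integral>\<omega>. a \<omega> \<partial>M) + 2 * \<theta> * ((\<integral>\<omega>. b \<omega> \<partial>M) - k * (\<integral>\<omega>. a \<omega> \<partial>M) + G * (\<integral>\<omega>. e \<omega> \<partial>M))"
      if "integrable M a" "integrable M b" "integrable M e" for a b e and k :: real
      using that by simp
    have E: "(\<integral>\<omega>. exp (s * Z \<omega>) * ln (exp (s * Z \<omega>)) \<partial>M) = E + G * ln G"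
      unfolding E_def Ent_def G_def by simp
    show ?thesis
      unfolding lin[OF i1 i2 em(1)] E by (simp add: G_def[symmetric] algebra_simps)
  qed
  also have "\<dots> \<le> L * G + 2 * \<theta> * (E - G + G * 2)"
    using th L G em(2) by (intro add_mono mult_left_mono) auto
  finally have "I \<le> L * G + 2 * \<theta> * (E + G)" by (simp add: algebra_simps)
  then have "E \<le> s\<^sup>2 * (L * G + 2 * \<theta> * (E + G))"
    using EI by (meson mult_left_mono order_trans zero_le_power2)
  then have main: "E * (1 - 2 * \<theta> * s\<^sup>2) \<le> s\<^sup>2 * G * (L + 2 * \<theta>)"
    by (simp add: algebra_simps)
  have rhs: "0 \<le> s\<^sup>2 * G * L" using G L by simp
  show ?thesis
  proof (cases "E \<le> 0")
    case True
    then show ?thesis using G L th unfolding E_def[symmetric] G_def[symmetric]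
      by (meson add_nonneg_nonneg less_imp_le mult_nonneg_nonneg order_trans zero_le_numeral zero_le_power2)
  next
    case False
    then have "E * (1 / 2) \<le> E * (1 - 2 * \<theta> * s\<^sup>2)" using s by (intro mult_left_mono) auto
    with main have "E \<le> 2 * (s\<^sup>2 * G * (L + 2 * \<theta>))" by simp
    also have "\<dots> \<le> 4 * (L + \<theta>) * s\<^sup>2 * G" using rhs by (simp add: algebra_simps)
    finally show ?thesis unfolding E_def G_def .
  qed
qed

section \<open>Herbst's argument by halving\<close>

text \<open>
  Let \<open>m\<close> be the mean of \<open>s Z\<close> under the tilted measure with density \<open>exp (s Z) / G s\<close>. The
  entropy of \<open>exp (s Z)\<close> is \<open>G s * (m - ln (G s))\<close>, and Jensen's inequality under the tilted
  measure gives \<open>G (s/2) / G s \<ge> exp (- m / 2)\<close>. Eliminating \<open>m\<close> yields the claim without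
  differentiating \<open>G\<close>.
\<close>

lemma (in prob_space) cumulant_halving:
  fixes Z :: "'a \<Rightarrow> real" and s K :: real
  assumes i1: "integrable M (\<lambda>\<omega>. exp (s * Z \<omega>))"
    and i2: "integrable M (\<lambda>\<omega>. exp (s * Z \<omega>) * ln (exp (s * Z \<omega>)))"
    and i3: "integrable M (\<lambda>\<omega>. exp (s / 2 * Z \<omega>))"
    and ent: "Ent M (\<lambda>\<omega>. exp (s * Z \<omega>)) \<le> K * s\<^sup>2 * (\<integral>\<omega>. exp (s * Z \<omega>) \<partial>M)"
  shows "ln (\<integral>\<omega>. exp (s * Z \<omega>) \<partial>M) \<le> 2 * ln (\<integral>\<omega>. exp (s / 2 * Z \<omega>) \<partial>M) + K * s\<^sup>2"
proof -
  define G where "G = (\<integral>\<omega>. exp (s * Z \<omega>) \<partial>M)"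
  define H where "H = (\<integral>\<omega>. exp (s / 2 * Z \<omega>) \<partial>M)"
  define m where "m = (\<integral>\<omega>. exp (s * Z \<omega>) * (s * Z \<omega>) \<partial>M) / G"
  have i2': "integrable M (\<lambda>\<omega>. exp (s * Z \<omega>) * (s * Z \<omega>))" using i2 by simp
  have G: "G > 0" and H: "H > 0" unfolding G_def H_def using i1 i3 integral_exp_pos by auto
  have mG: "(\<integral>\<omega>. exp (s * Z \<omega>) * (s * Z \<omega>) \<partial>M) = m * G" using G by (simp add: m_def)
  have "G * (m - ln G) \<le> G * (K * s\<^sup>2)"
    using ent unfolding Ent_def G_def[symmetric] ln_exp mG by (simp add: algebra_simps)
  then have m: "m \<le> ln G + K * s\<^sup>2" using G by simp
  \<comment> \<open>The tangent-line inequality behind Jensen's inequality, for \<open>exp (- x / 2)\<close> at \<open>x = m\<close>.\<close>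
  have pt: "exp (- m / 2) * ((1 + m / 2) * exp (s * Z \<omega>) - (1 / 2) * (exp (s * Z \<omega>) * (s * Z \<omega>)))
      \<le> exp (s / 2 * Z \<omega>)" for \<omega>
  proof -
    have "1 + (m - s * Z \<omega>) / 2 \<le> exp ((m - s * Z \<omega>) / 2)" by (rule exp_ge_add_one_self)
    then have "exp (- m / 2) * exp (s * Z \<omega>) * (1 + (m - s * Z \<omega>) / 2)
        \<le> exp (- m / 2) * exp (s * Z \<omega>) * exp ((m - s * Z \<omega>) / 2)"
      by (intro mult_left_mono) auto
    also have "\<dots> = exp (s / 2 * Z \<omega>)"
      by (simp add: exp_add[symmetric] field_simps)
    finally show ?thesis by (simp add: algebra_simps add_divide_distrib diff_divide_distrib)
  qed
  have "exp (- m / 2) * ((1 + m / 2) * G - (1 / 2) * (m * G))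
     = (\<integral>\<omega>. exp (- m / 2) * ((1 + m / 2) * exp (s * Z \<omega>)
          - (1 / 2) * (exp (s * Z \<omega>) * (s * Z \<omega>))) \<partial>M)"
  proof -
    have lin: "(\<integral>\<omega>. p * (q * a \<omega> - r * b \<omega>) \<partial>M) = p * (q * (\<integral>\<omega>. a \<omega> \<partial>M) - r * (\<integral>\<omega>. b \<omega> \<partial>M))"
      if "integrable M a" "integrable M b" for a b and p q r :: real
      using that by simp
    show ?thesis
      by (subst lin[OF i1 i2']) (simp only: mG G_def[symmetric])
  qed
  also have "\<dots> \<le> H"
    unfolding H_def
    by (intro integral_mono pt integrable_mult_right Bochner_Integration.integrable_diff i1 i2' i3)
  finally have "exp (- m / 2) * G \<le> H" by (simp add: algebra_simps)
  then have "ln (exp (- m / 2) * G) \<le> ln H" using G H by (subst ln_le_cancel_iff) auto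
  then have "ln G - m / 2 \<le> ln H" using G by (simp add: ln_mult)
  with m show ?thesis unfolding G_def[symmetric] H_def[symmetric] by linarith
qed

text \<open>
  One-sided differentiability of the moment generating function at 0 along \<open>s / 2 ^ n\<close>. Only the
  integrability of \<open>Z\<close> and moments on one side of 0 are available; the difference
  quotients lie between \<open>s Z\<close> and \<open>exp (s Z)\<close>, which gives dominated convergence.
\<close>

lemma (in prob_space) difference_quotient_mgf_limit:
  fixes Z :: "'a \<Rightarrow> real" and s :: real
  assumes Z: "integrable M Z" and i: "integrable M (\<lambda>\<omega>. exp (s * Z \<omega>))"
    and i': "\<And>n. integrable M (\<lambda>\<omega>. exp (s / 2 ^ n * Z \<omega>))"
  shows "(\<lambda>n. 2 ^ n * ((\<integral>\<omega>. exp (s / 2 ^ n * Z \<omega>) \<partial>M) - 1)) \<longlonglongrightarrow> s * (\<integral>\<omega>. Z \<omega> \<partial>M)"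
proof -
  have [measurable]: "Z \<in> borel_measurable M" using Z by simp
  have "(\<lambda>n. \<integral>\<omega>. 2 ^ n * (exp (s / 2 ^ n * Z \<omega>) - 1) \<partial>M) \<longlonglongrightarrow> (\<integral>\<omega>. s * Z \<omega> \<partial>M)"
  proof (rule integral_dominated_convergence[where w = "\<lambda>\<omega>. \<bar>s * Z \<omega>\<bar> + exp (s * Z \<omega>)"])
    show "integrable M (\<lambda>\<omega>. \<bar>s * Z \<omega>\<bar> + exp (s * Z \<omega>))" using Z i by auto
    show "AE \<omega> in M. (\<lambda>n. 2 ^ n * (exp (s / 2 ^ n * Z \<omega>) - 1)) \<longlonglongrightarrow> s * Z \<omega>"
    proof (rule AE_I2)
      fix \<omega>
      have "((\<lambda>h. (exp (h * (s * Z \<omega>)) - 1) / h) \<longlongrightarrow> s * Z \<omega>) (at_right 0)"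
        by real_asymp
      moreover have "filterlim (\<lambda>n. 1 / 2 ^ n :: real) (at_right 0) sequentially"
        by real_asymp
      ultimately have "(\<lambda>n. (exp (1 / 2 ^ n * (s * Z \<omega>)) - 1) / (1 / 2 ^ n)) \<longlonglongrightarrow> s * Z \<omega>"
        by (rule filterlim_compose)
      then show "(\<lambda>n. 2 ^ n * (exp (s / 2 ^ n * Z \<omega>) - 1)) \<longlonglongrightarrow> s * Z \<omega>"
        by (simp add: mult.commute)
    qed
    show "AE \<omega> in M. norm (2 ^ n * (exp (s / 2 ^ n * Z \<omega>) - 1)) \<le> \<bar>s * Z \<omega>\<bar> + exp (s * Z \<omega>)" for n
    proof (rule AE_I2)
      fix \<omega>
      define a where "a = s / 2 ^ n * Z \<omega>"
      have a: "s * Z \<omega> = of_nat (2 ^ n) * a" by (simp add: a_def)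
      have "a \<le> exp a - 1" using exp_ge_add_one_self[of a] by linarith
      then have lo: "2 ^ n * a \<le> 2 ^ n * (exp a - 1)" by (intro mult_left_mono) auto
      \<comment> \<open>Bernoulli's inequality for the base \<open>exp a\<close> replaces convexity of the exponential.\<close>
      have "1 + real (2 ^ n) * (exp a - 1) \<le> (1 + (exp a - 1)) ^ (2 ^ n)"
        by (rule Bernoulli_inequality) simp
      then have "1 + real (2 ^ n) * (exp a - 1) \<le> exp (s * Z \<omega>)"
        unfolding a by (subst exp_of_nat_mult) simp
      moreover have "2 ^ n * (exp a - 1) = real (2 ^ n) * (exp a - 1)" "s * Z \<omega> = 2 ^ n * a"
        using a by simp_all
      ultimately show "norm (2 ^ n * (exp (s / 2 ^ n * Z \<omega>) - 1)) \<le> \<bar>s * Z \<omega>\<bar> + exp (s * Z \<omega>)"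
        using lo exp_gt_zero[of "s * Z \<omega>"] unfolding a_def[symmetric] real_norm_def by linarith
    qed
  qed auto
  then show ?thesis using i' by (simp add: prob_space)
qed

lemma (in prob_space) Herbst_mgf_bound:
  fixes Z :: "'a \<Rightarrow> real" and s K :: real
  assumes Z: "integrable M Z" and s: "s > 0" and K: "K \<ge> 0"
    and i1: "\<And>r. 0 < r \<Longrightarrow> r \<le> s \<Longrightarrow> integrable M (\<lambda>\<omega>. exp (r * Z \<omega>))"
    and i2: "\<And>r. 0 < r \<Longrightarrow> r \<le> s \<Longrightarrow> integrable M (\<lambda>\<omega>. exp (r * Z \<omega>) * ln (exp (r * Z \<omega>)))"
    and ent: "\<And>r. 0 < r \<Longrightarrow> r \<le> s \<Longrightarrow>
      Ent M (\<lambda>\<omega>. exp (r * Z \<omega>)) \<le> K * r\<^sup>2 * (\<integral>\<omega>. exp (r * Z \<omega>) \<partial>M)"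
  shows "(\<integral>\<omega>. exp (s * Z \<omega>) \<partial>M) \<le> exp (s * (\<integral>\<omega>. Z \<omega> \<partial>M) + 2 * K * s\<^sup>2)"
proof -
  define G where "G r = (\<integral>\<omega>. exp (r * Z \<omega>) \<partial>M)" for r
  have le: "0 < s / 2 ^ n" "s / 2 ^ n \<le> s" for n
    using s by (auto simp: divide_le_eq)
  have G: "G (s / 2 ^ n) > 0" for n
    unfolding G_def by (rule integral_exp_pos) (rule i1[OF le])
  \<comment> \<open>The \<open>k\<close>-th halving costs \<open>K * s\<^sup>2 / 2 ^ k\<close>; the costs for \<open>k < n\<close> form a geometric sum.\<close>
  have it: "ln (G s) \<le> 2 ^ n * ln (G (s / 2 ^ n)) + 2 * K * s\<^sup>2 * (1 - 1 / 2 ^ n)" for n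
  proof (induction n)
    case 0
    then show ?case by simp
  next
    case (Suc n)
    have "ln (G (s / 2 ^ n)) \<le> 2 * ln (G (s / 2 ^ n / 2)) + K * (s / 2 ^ n)\<^sup>2"
      unfolding G_def using i1[OF le, of "Suc n"]
      by (intro cumulant_halving i1[OF le] i2[OF le] ent[OF le]) (simp add: field_simps)
    then have "2 ^ n * ln (G (s / 2 ^ n))
        \<le> 2 ^ n * (2 * ln (G (s / 2 ^ n / 2)) + K * (s / 2 ^ n)\<^sup>2)"
      by (intro mult_left_mono) auto
    also have "\<dots> = 2 ^ Suc n * ln (G (s / 2 ^ Suc n)) + K * s\<^sup>2 / 2 ^ n"
      by (simp add: field_simps power2_eq_square)
    finally have "ln (G s) \<le> 2 ^ Suc n * ln (G (s / 2 ^ Suc n)) + K * s\<^sup>2 / 2 ^ n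
        + 2 * K * s\<^sup>2 * (1 - 1 / 2 ^ n)"
      using Suc by linarith
    moreover have "K * s\<^sup>2 / 2 ^ n + 2 * K * s\<^sup>2 * (1 - 1 / 2 ^ n)
        = 2 * K * s\<^sup>2 * (1 - 1 / 2 ^ Suc n)"
      by (simp add: field_simps)
    ultimately show ?case by linarith
  qed
  have "ln (G s) \<le> 2 ^ n * (G (s / 2 ^ n) - 1) + 2 * K * s\<^sup>2" for n
  proof -
    have "2 ^ n * ln (G (s / 2 ^ n)) \<le> 2 ^ n * (G (s / 2 ^ n) - 1)"
      by (intro mult_left_mono ln_le_minus_one G) auto
    moreover have "2 * K * s\<^sup>2 * (1 - 1 / 2 ^ n) \<le> 2 * K * s\<^sup>2 * 1"
      using K by (intro mult_left_mono) auto
    ultimately show ?thesis using it[of n] by linarith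
  qed
  moreover have "(\<lambda>n. 2 ^ n * (G (s / 2 ^ n) - 1) + 2 * K * s\<^sup>2)
      \<longlonglongrightarrow> s * (\<integral>\<omega>. Z \<omega> \<partial>M) + 2 * K * s\<^sup>2"
    unfolding G_def using s
    by (intro tendsto_add tendsto_const difference_quotient_mgf_limit Z i1[OF le] i1) auto
  ultimately have "ln (G s) \<le> s * (\<integral>\<omega>. Z \<omega> \<partial>M) + 2 * K * s\<^sup>2"
    by (intro LIMSEQ_le_const) auto
  then have "exp (ln (G s)) \<le> exp (s * (\<integral>\<omega>. Z \<omega> \<partial>M) + 2 * K * s\<^sup>2)"
    by (rule exp_le_cancel_iff[THEN iffD2])
  then show ?thesis using G[of 0] by (simp add: G_def del: exp_le_cancel_iff)
qed

section \<open>Tail bounds\<close>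

lemma (in prob_space) upper_tail:
  fixes Z W :: "'a \<Rightarrow> real" and L \<theta> t :: real
  assumes L: "L > 0" and th: "\<theta> > 0" and Wm: "W \<in> borel_measurable M" and Z: "integrable M Z"
    and eb: "\<And>s. s > 0 \<Longrightarrow> entropy_bound M Z W s"
    and tail: "\<And>t. t \<ge> 0 \<Longrightarrow> measure M {\<omega> \<in> space M. W \<omega> > L + \<theta> * t} \<le> exp (- t)"
    and t: "t \<ge> 0"
  shows "measure M {\<omega> \<in> space M. Z \<omega> - (\<integral>\<omega>'. Z \<omega>' \<partial>M) > t}
    \<le> exp (- (1 / 32) * min (t\<^sup>2 / (L + \<theta>)) (t / sqrt \<theta>))"
proof (cases "t = 0")
  case True
  then show ?thesis by simp
next
  case False
  with t have t: "t > 0" by simp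
  have [measurable]: "Z \<in> borel_measurable M" using Z by simp
  define \<mu> where "\<mu> = (\<integral>\<omega>. Z \<omega> \<partial>M)"
  \<comment> \<open>The first entry minimises \<open>8 * (L + \<theta>) * s\<^sup>2 - s * t\<close>; the second is the largest \<open>s\<close>
      for which the entropy can be absorbed.\<close>
  define s where "s = min (t / (16 * (L + \<theta>))) (1 / (2 * sqrt \<theta>))"
  have s: "s > 0" using t L th by (simp add: s_def)
  have small: "4 * \<theta> * r\<^sup>2 \<le> 1" if "0 < r" "r \<le> s" for r
  proof -
    have "r \<le> 1 / (2 * sqrt \<theta>)" using that by (simp add: s_def)
    then have "r\<^sup>2 \<le> (1 / (2 * sqrt \<theta>))\<^sup>2" using that by (intro power_mono) auto
    also have "\<dots> = 1 / (4 * \<theta>)" using th by (simp add: power_divide power_mult_distrib)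
    finally show ?thesis using th by (simp add: field_simps)
  qed
  have mgf: "(\<integral>\<omega>. exp (s * Z \<omega>) \<partial>M) \<le> exp (s * \<mu> + 2 * (4 * (L + \<theta>)) * s\<^sup>2)"
    unfolding \<mu>_def
  proof (rule Herbst_mgf_bound[OF Z s])
    show "4 * (L + \<theta>) \<ge> 0" using L th by simp
    fix r assume r: "0 < r" "r \<le> s"
    show "integrable M (\<lambda>\<omega>. exp (r * Z \<omega>))"
      and "integrable M (\<lambda>\<omega>. exp (r * Z \<omega>) * ln (exp (r * Z \<omega>)))"
      using eb[OF r(1)] by (auto simp: entropy_bound_def)
    show "Ent M (\<lambda>\<omega>. exp (r * Z \<omega>)) \<le> 4 * (L + \<theta>) * r\<^sup>2 * (\<integral>\<omega>. exp (r * Z \<omega>) \<partial>M)"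
      by (rule entropy_self_bound[OF Wm th L tail eb[OF r(1)] small[OF r]])
  qed
  have "measure M {\<omega> \<in> space M. Z \<omega> - \<mu> > t}
      \<le> measure M {\<omega> \<in> space M. exp (s * (\<mu> + t)) \<le> exp (s * Z \<omega>)}"
    using s by (intro finite_measure_mono) (auto intro!: mult_left_mono)
  also have "\<dots> \<le> (\<integral>\<omega>. exp (s * Z \<omega>) \<partial>M) / exp (s * (\<mu> + t))"
    using eb[OF s] by (intro integral_Markov_inequality_measure[where A = "{}"])
      (auto simp: entropy_bound_def)
  also have "\<dots> \<le> exp (s * \<mu> + 2 * (4 * (L + \<theta>)) * s\<^sup>2) / exp (s * (\<mu> + t))"
    by (intro divide_right_mono mgf) simp
  also have "\<dots> = exp (8 * (L + \<theta>) * s\<^sup>2 - s * t)"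
    by (simp add: exp_diff[symmetric] algebra_simps)
  also have "\<dots> \<le> exp (- (1 / 32) * min (t\<^sup>2 / (L + \<theta>)) (t / sqrt \<theta>))"
  proof -
    have "s \<le> t / (16 * (L + \<theta>))" by (simp add: s_def)
    then have "16 * (L + \<theta>) * s \<le> t" using L th by (simp add: field_simps)
    then have "16 * (L + \<theta>) * s * s \<le> t * s" using s by (intro mult_right_mono) auto
    then have 1: "8 * (L + \<theta>) * s\<^sup>2 - s * t \<le> - (s * t / 2)"
      by (simp add: power2_eq_square algebra_simps)
    define m where "m = min (t\<^sup>2 / (L + \<theta>)) (t / sqrt \<theta>)"
    have m0: "m \<ge> 0" using t L th by (simp add: m_def)
    have "m / 32 \<le> s * t / 2"
    proof (cases "s = t / (16 * (L + \<theta>))")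
      case True
      have "m \<le> t\<^sup>2 / (L + \<theta>)" by (simp add: m_def)
      then have "m / 32 \<le> t\<^sup>2 / (L + \<theta>) / 32" by (rule divide_right_mono) simp
      also have "\<dots> = s * t / 2" using L th unfolding True by (simp add: field_simps power2_eq_square)
      finally show ?thesis .
    next
      case False
      then have s': "s = 1 / (2 * sqrt \<theta>)" by (auto simp: s_def min_def split: if_splits)
      have "m \<le> t / sqrt \<theta>" by (simp add: m_def)
      then have "m / 4 \<le> s * t / 2" unfolding s' by simp
      with m0 show ?thesis by linarith
    qed
    with 1 show ?thesis unfolding m_def[symmetric] by simp
  qed
  finally show ?thesis unfolding \<mu>_def .
qed

lemma entropy_bound_uminus:
  "entropy_bound M (\<lambda>\<omega>. - Z \<omega>) W s \<longleftrightarrow> entropy_bound M Z W (- s)"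
  by (simp add: entropy_bound_def)

lemma tail_constant_1_32: "tail_constant TYPE('a) (1 / 32)"
  unfolding tail_constant_def
proof (intro allI impI conjI)
  fix M :: "'a measure" and Z W :: "'a \<Rightarrow> real" and L \<theta> t :: real
  assume "prob_space M" and L: "L > 0" and th: "\<theta> > 0" and t: "t \<ge> 0"
    and [measurable]: "Z \<in> borel_measurable M" and Wm: "W \<in> borel_measurable M"
    and Z: "integrable M Z" and eb: "\<forall>s>0. entropy_bound M Z W s"
    and tail: "\<forall>t\<ge>0. measure M {\<omega> \<in> space M. W \<omega> > L + \<theta> * t} \<le> exp (- t)"
  interpret prob_space M by fact
  let ?B = "exp (- (1 / 32) * min (t\<^sup>2 / (L + \<theta>)) (t / sqrt \<theta>))"
  define \<mu> where "\<mu> = (\<integral>\<omega>. Z \<omega> \<partial>M)"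
  show up: "measure M {\<omega> \<in> space M. Z \<omega> - (\<integral>\<omega>'. Z \<omega>' \<partial>M) > t} \<le> ?B"
    by (rule upper_tail[OF L th Wm Z _ _ t]) (use eb tail in auto)
  assume eb': "\<forall>s\<le>0. entropy_bound M Z W s"
  have "measure M {\<omega> \<in> space M. - Z \<omega> - (\<integral>\<omega>'. - Z \<omega>' \<partial>M) > t} \<le> ?B"
    by (rule upper_tail[OF L th Wm _ _ _ t]) (use Z eb' tail in \<open>auto simp: entropy_bound_uminus\<close>)
  then have lo: "measure M {\<omega> \<in> space M. - Z \<omega> + \<mu> > t} \<le> ?B"
    by (simp add: \<mu>_def)
  have "measure M {\<omega> \<in> space M. \<bar>Z \<omega> - \<mu>\<bar> > t}
      \<le> measure M ({\<omega> \<in> space M. Z \<omega> - \<mu> > t} \<union> {\<omega> \<in> space M. - Z \<omega> + \<mu> > t})"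
    by (intro finite_measure_mono) auto
  also have "\<dots> \<le> measure M {\<omega> \<in> space M. Z \<omega> - \<mu> > t}
      + measure M {\<omega> \<in> space M. - Z \<omega> + \<mu> > t}"
    by (intro measure_Un_le) auto
  also have "\<dots> \<le> 2 * ?B" using up lo unfolding \<mu>_def[symmetric] by linarith
  finally show "measure M {\<omega> \<in> space M. \<bar>Z \<omega> - (\<integral>\<omega>'. Z \<omega>' \<partial>M)\<bar> > t} \<le> 2 * ?B"
    unfolding \<mu>_def .
qed

section \<open>Independence of the sample type\<close>

lemma entropy_bound_distr:
  fixes Z W :: "'a \<Rightarrow> real"
  assumes [measurable]: "Z \<in> borel_measurable M" "W \<in> borel_measurable M"
  shows "entropy_bound (distr M (borel \<Otimes>\<^sub>M borel) (\<lambda>\<omega>. (Z \<omega>, W \<omega>))) fst snd s \<longleftrightarrow> entropy_bound M Z W s"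
  unfolding entropy_bound_def Ent_def
  by (subst integrable_distr_eq integral_distr; (measurable | simp))+

text \<open>The hypotheses are pushed forward to the joint law of \<open>(Z, W)\<close>, with the projections as variables.\<close>

lemma tail_constant_transfer:
  assumes "tail_constant TYPE(real \<times> real) c"
  shows "tail_constant TYPE('a) c"
  unfolding tail_constant_def
proof (intro allI impI)
  fix M :: "'a measure" and Z W :: "'a \<Rightarrow> real" and L \<theta> :: real
  assume M: "prob_space M" and L: "L > 0" and th: "\<theta> > 0"
    and m[measurable]: "Z \<in> borel_measurable M" "W \<in> borel_measurable M"
    and Z: "integrable M Z" and eb: "\<forall>s>0. entropy_bound M Z W s"
    and tail: "\<forall>t\<ge>0. measure M {\<omega> \<in> space M. W \<omega> > L + \<theta> * t} \<le> exp (- t)"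
  let ?X = "\<lambda>\<omega>. (Z \<omega>, W \<omega>)"
  define N where "N = distr M (borel \<Otimes>\<^sub>M borel) ?X"
  have "prob_space N" unfolding N_def by (intro prob_space.prob_space_distr M) measurable
  moreover have "fst \<in> borel_measurable N" "snd \<in> borel_measurable N"
    unfolding N_def by measurable
  moreover have "integrable N fst"
    unfolding N_def using Z by (subst integrable_distr_eq) auto
  moreover have mean: "(\<integral>x. fst x \<partial>N) = (\<integral>\<omega>. Z \<omega> \<partial>M)"
    unfolding N_def by (subst integral_distr) auto
  moreover have ent: "entropy_bound N fst snd s \<longleftrightarrow> entropy_bound M Z W s" for s
    unfolding N_def by (rule entropy_bound_distr[OF m])
  moreover have meas: "measure N {x \<in> space N. P x} = measure M {\<omega> \<in> space M. P (Z \<omega>, W \<omega>)}"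
    if "Measurable.pred (borel \<Otimes>\<^sub>M borel) P" for P
    unfolding N_def using that
    by (subst measure_distr) (auto simp: pred_def space_pair_measure intro!: arg_cong[where f = "measure M"])
  moreover have "measure N {x \<in> space N. snd x > a} = measure M {\<omega> \<in> space M. W \<omega> > a}" for a
    by (subst meas) auto
  moreover have "measure N {x \<in> space N. fst x - a > b} = measure M {\<omega> \<in> space M. Z \<omega> - a > b}" for a b
    by (subst meas) auto
  moreover have "measure N {x \<in> space N. \<bar>fst x - a\<bar> > b} = measure M {\<omega> \<in> space M. \<bar>Z \<omega> - a\<bar> > b}" for a b
    by (subst meas) auto
  ultimately show "(\<forall>t\<ge>0. measure M {\<omega> \<in> space M. Z \<omega> - (\<integral>\<omega>'. Z \<omega>' \<partial>M) > t}
                 \<le> exp (- c * min (t\<^sup>2 / (L + \<theta>)) (t / sqrt \<theta>))) \<and>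
        ((\<forall>s\<le>0. entropy_bound M Z W s) \<longrightarrow>
          (\<forall>t\<ge>0. measure M {\<omega> \<in> space M. \<bar>Z \<omega> - (\<integral>\<omega>'. Z \<omega>' \<partial>M)\<bar> > t}
                   \<le> 2 * exp (- c * min (t\<^sup>2 / (L + \<theta>)) (t / sqrt \<theta>))))"
    using assms[unfolded tail_constant_def, rule_format, of N L \<theta> fst snd] L th eb tail by simp
qed

theorem lemma1p3:
  shows "(\<exists>c>0. tail_constant TYPE(real \<times> real) c) \<and>
    (\<forall>c>0. tail_constant TYPE(real \<times> real) c \<longrightarrow> tail_constant TYPE('a) c)"
proof (intro conjI allI impI)
  show "\<exists>c>0. tail_constant TYPE(real \<times> real) c"
    using tail_constant_1_32 by (intro exI[of _ "1 / 32"]) auto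
  show "tail_constant TYPE('a) c" if "tail_constant TYPE(real \<times> real) c" for c
    using that by (rule tail_constant_transfer)
qed

end
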